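(* Let $m,n\ge 1$, let $Y=\{y^i\}_{i=1}^n$ be a collection (repetitions allowed) of vectors in $\mathbb{R}^m$, and let $\rho: Y\times Y\to[0,m]$ be a complexity-reducing relation on $Y$. Let $G=(Y,E)$ be the complete undirected weighted graph whose nodes are the $n$ members of $Y$, in which every pair of members $y^i,y^j$ ($i\neq j$) is joined by an edge of weight $\rho(y^i,y^j)$. Let $g\in\mathbb{R}^m$ be arbitrary. Then the total number of multiply-add pairs needed to compute the collection $\{(y^i)^t g\}_{i=1}^n$ is no greater than $m'+w$, where $m'$ is the minimum, over the members $y$ of $Y$, of the number of nonzero entries of $y$, and $w$ is the weight of a minimum spanning tree of $G$.
   Context: Cost model. The vectors in $Y$ are fixed and known in advance, and $g\in\mathbb{R}^m$ is an arbitrary input. A computation is a finite sequence of steps (chosen depending on $Y$ but not on $g$). Cost is the number of multiply-add pairs (MAPs) used, where one MAP is an operation $a+bc$ whose operands are real constants independent of $g$ (for example, entries of vectors of $Y$ or numbers derived from them), entries of $g$, or quantities already computed. Reusing an already computed value and changing its sign cost no MAPs. For example, computing $y^t g$ directly costs as many MAPs as $y$ has nonzero entries (at most $m$). Members of the collection $Y=\{y^i\}_{i=1}^n$ are indexed by $i$; members with different indices count as distinct even if they are equal as vectors. Definition (complexity-reducing). A symmetric function $\rho:Y\times Y\to[0,m]$ is called complexity-reducing (a complexity-reducing relation) if for every $y,z\in Y$ with $\rho(y,z)\le k<m$, for every $g\in\mathbb{R}^m$ the number $y^t g$ may be computed, using the result $z^t g$ (regarded as already computed), in no more than $k$ multiply-add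 pairs. The weight of a spanning tree is the sum of the weights of its edges; a minimum spanning tree is a spanning tree of smallest weight. *)

theory Defs
  imports "HOL-Analysis.Analysis"
begin

section \<open>Cost model\<close>

text \<open>
  A computation is a straight-line program all of whose steps are multiply-add pairs.
  \<open>Available k\<close> is the \<open>k\<close>-th quantity known so far: first the quantities regarded as already
  computed, then the results of the preceding steps. \<open>Neg\<close> is the free change of sign.
\<close>

datatype 'm operand = Const real | Entry 'm | Available nat | Neg "'m operand"

fun legal_operand :: "nat \<Rightarrow> 'm operand \<Rightarrow> bool" where
  "legal_operand s (Const c) \<longleftrightarrow> True"
| "legal_operand s (Entry l) \<longleftrightarrow> True"
| "legal_operand s (Available k) \<longleftrightarrow> k < s"
| "legal_operand s (Neg a) \<longleftrightarrow> legal_operand s a"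

fun operand_value :: "real^'m \<Rightarrow> real list \<Rightarrow> 'm operand \<Rightarrow> real" where
  "operand_value g vs (Const c) = c"
| "operand_value g vs (Entry l) = g $ l"
| "operand_value g vs (Available k) = vs ! k"
| "operand_value g vs (Neg a) = - operand_value g vs a"

text \<open>The step \<open>(a, b, c)\<close> computes \<open>a + b * c\<close>.\<close>

type_synonym 'm computation = "('m operand \<times> 'm operand \<times> 'm operand) list"

fun legal_computation :: "nat \<Rightarrow> 'm computation \<Rightarrow> bool" where
  "legal_computation s [] \<longleftrightarrow> True"
| "legal_computation s ((a, b, c) # p) \<longleftrightarrow>
     legal_operand s a \<and> legal_operand s b \<and> legal_operand s c \<and> legal_computation (Suc s) p"

fun run :: "real^'m \<Rightarrow> real list \<Rightarrow> 'm computation \<Rightarrow> real list" where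
  "run g vs [] = vs"
| "run g vs ((a, b, c) # p) =
     run g (vs @ [operand_value g vs a + operand_value g vs b * operand_value g vs c]) p"

text \<open>
  Given the numbers \<open>z \<bullet> g\<close> for \<open>z\<close> in the list \<open>Z\<close>, at most \<open>k\<close> multiply-add pairs suffice to
  compute \<open>y \<bullet> g\<close> for all \<open>y\<close> in \<open>F\<close>. The program and the places \<open>r\<close> of its results
  must not depend on \<open>g\<close>.
  A result may be any operand, because reusing a known quantity and changing its sign are free;
  in particular, the zero vector has cost \<open>0\<close>.
\<close>

definition computable_within :: "(real^'m) list \<Rightarrow> (real^'m) set \<Rightarrow> real \<Rightarrow> bool" where
  "computable_within Z F k \<longleftrightarrow>
     (\<exists>p. legal_computation (length Z) p \<and> real (length p) \<le> k \<and>
        (\<forall>y\<in>F. \<exists>r. legal_operand (length Z + length p) r \<and>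
           (\<forall>g. operand_value g (run g (map (\<lambda>z. z \<bullet> g) Z) p) r = y \<bullet> g)))"

section \<open>Complexity-reducing relations\<close>

text \<open>
  The collection is the family \<open>Y 1, \<dots>, Y n\<close>, and \<open>\<rho>\<close> is a function of the indices, so that equal
  vectors with different indices remain distinct members. The bound \<open>k\<close> ranges over the reals, like
  the values of \<open>\<rho>\<close>: with \<open>k\<close> restricted to integers, a value such as \<open>1/2\<close> would permit the use of
  one multiply-add pair.
\<close>

definition complexity_reducing ::
    "nat \<Rightarrow> (nat \<Rightarrow> real^'m) \<Rightarrow> (nat \<Rightarrow> nat \<Rightarrow> real) \<Rightarrow> bool" where
  "complexity_reducing n Y \<rho> \<longleftrightarrow>
     (\<forall>i\<in>{1..n}. \<forall>j\<in>{1..n}. 0 \<le> \<rho> i j \<and> \<rho> i j \<le> real CARD('m) \<and> \<rho> i j = \<rho> j i) \<and>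
     (\<forall>i\<in>{1..n}. \<forall>j\<in>{1..n}. \<forall>k. \<rho> i j \<le> k \<and> k < real CARD('m) \<longrightarrow>
        computable_within [Y j] {Y i} k)"

section \<open>Minimum spanning trees\<close>

text \<open>
  Undirected graphs are given by a vertex set and a set of two-element edges.
  (The predicates \<open>tree\<close> and \<open>spanning_tree\<close> of the AFP entry \<open>Graph_Theory\<close> exclude directed
  cycles only, hence do not express the undirected notion.)
\<close>

definition complete_edges :: "'a set \<Rightarrow> 'a set set" where
  "complete_edges V = {{u, v} | u v. u \<in> V \<and> v \<in> V \<and> u \<noteq> v}"

definition connected_graph :: "'a set \<Rightarrow> 'a set set \<Rightarrow> bool" where
  "connected_graph V E \<longleftrightarrow> (\<forall>u\<in>V. \<forall>v\<in>V. (u, v) \<in> {(a, b). {a, b} \<in> E}\<^sup>*)"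

definition graph_cycle :: "'a set set \<Rightarrow> 'a list \<Rightarrow> bool" where
  "graph_cycle E xs \<longleftrightarrow> 3 \<le> length xs \<and> distinct xs \<and>
     (\<forall>i<length xs. {xs ! i, xs ! (Suc i mod length xs)} \<in> E)"

definition spanning_tree :: "'a set \<Rightarrow> 'a set set \<Rightarrow> 'a set set \<Rightarrow> bool" where
  "spanning_tree V E T \<longleftrightarrow> T \<subseteq> E \<and> connected_graph V T \<and> (\<nexists>xs. graph_cycle T xs)"

definition minimum_spanning_tree ::
    "'a set \<Rightarrow> 'a set set \<Rightarrow> ('a set \<Rightarrow> real) \<Rightarrow> 'a set set \<Rightarrow> bool" where
  "minimum_spanning_tree V E wt T \<longleftrightarrow> spanning_tree V E T \<and>
     (\<forall>T'. spanning_tree V E T' \<longrightarrow> sum wt T \<le> sum wt T')"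

definition edge_weight :: "('a \<Rightarrow> 'a \<Rightarrow> real) \<Rightarrow> 'a set \<Rightarrow> real" where
  "edge_weight \<rho> e = (THE x. \<exists>u v. e = {u, v} \<and> x = \<rho> u v)"

lemma edge_weight_eq:
  assumes "\<rho> u v = \<rho> v u"
  shows "edge_weight \<rho> {u, v} = \<rho> u v"
  unfolding edge_weight_def using assms
  by (intro the_equality) (auto simp: doubleton_eq_iff)

lemma finite_complete_edges: "finite V \<Longrightarrow> finite (complete_edges V)"
  by (rule finite_subset[of _ "Pow V"]) (auto simp: complete_edges_def)

lemma spanning_tree_star:
  assumes "c \<in> V"
  shows "spanning_tree V (complete_edges V) {{c, v} | v. v \<in> V \<and> v \<noteq> c}"
    (is "spanning_tree _ _ ?T")
  unfolding spanning_tree_def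
proof (intro conjI notI)
  show "?T \<subseteq> complete_edges V"
    using assms by (auto simp: complete_edges_def)
  let ?R = "{(a, b). {a, b} \<in> ?T}"
  have "(c, v) \<in> ?R\<^sup>*" "(v, c) \<in> ?R\<^sup>*" if "v \<in> V" for v
  proof -
    have "{c, v} \<in> ?T" "{v, c} \<in> ?T" if "v \<noteq> c"
      using that \<open>v \<in> V\<close> by (auto simp: insert_commute)
    then show "(c, v) \<in> ?R\<^sup>*" "(v, c) \<in> ?R\<^sup>*"
      by (cases "v = c"; simp add: r_into_rtrancl)+
  qed
  then show "connected_graph V ?T"
    unfolding connected_graph_def by (intro ballI) (rule rtrancl_trans)
next
  assume "\<exists>xs. graph_cycle ?T xs"
  then obtain xs where len: "3 \<le> length xs" and dist: "distinct xs"
    and edge: "\<And>i. i < length xs \<Longrightarrow> {xs ! i, xs ! (Suc i mod length xs)} \<in> ?T"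
    unfolding graph_cycle_def by blast
  have c: "xs ! i = c \<or> xs ! (Suc i mod length xs) = c" if "i < length xs" for i
  proof -
    have "c \<in> {xs ! i, xs ! (Suc i mod length xs)}"
      using edge[OF that] by (elim CollectE exE conjE) (simp only: insertI1)
    then show ?thesis by auto
  qed
  have eq: "i = j" if "xs ! i = c" "xs ! j = c" "i < length xs" "j < length xs" for i j
    using that nth_eq_iff_index_eq[OF dist, of i j] by simp
  define k where "k = 3 mod length xs"
  have k: "k \<noteq> 1" "k < length xs"
    using len unfolding k_def by (cases "length xs = 3"; simp)+
  have "xs ! 0 = c \<or> xs ! 1 = c" "xs ! 1 = c \<or> xs ! 2 = c" "xs ! 2 = c \<or> xs ! k = c"
    using c[of 0] c[of 1] c[of 2] len
    by (cases "xs = []"; auto simp: k_def eval_nat_numeral)+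
  then show False
    using eq[of 0 2] eq[of 1 2] eq[of 1 k] k len by (cases "xs = []") auto
qed

lemma minimum_spanning_tree_exists:
  assumes "finite V" "V \<noteq> {}"
  shows "\<exists>T. minimum_spanning_tree V (complete_edges V) wt T"
proof -
  let ?S = "{T. spanning_tree V (complete_edges V) T}"
  have "finite ?S"
    by (rule finite_subset[of _ "Pow (complete_edges V)"])
      (auto simp: spanning_tree_def finite_complete_edges assms)
  moreover have "?S \<noteq> {}"
  proof -
    obtain c where "c \<in> V" using assms(2) by auto
    from spanning_tree_star[OF this] show ?thesis by (intro notI) simp
  qed
  ultimately have "\<exists>T\<in>?S. \<forall>T'\<in>?S. sum wt T \<le> sum wt T'"
    using arg_min_if_finite(1) arg_min_least by (intro bexI ballI)
  then show ?thesis
    by (simp add: minimum_spanning_tree_def Bex_def)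
qed

end

theory Submission
  imports Defs
begin

text \<open>
  Start from a member with the fewest nonzero entries and compute its product directly. As the tree
  is connected, some edge always joins the set \<open>S\<close> of members treated so far to a new member, whose
  product costs at most the weight of that edge. The cost thus never exceeds \<open>m'\<close> plus the weight of
  the tree edges inside \<open>S\<close>; the edge added at each step is new since it leaves \<open>S\<close>.
\<close>

section \<open>Composition of computations\<close>

lemma length_run [simp]: "length (run g vs p) = length vs + length p"
  by (induction g vs p rule: run.induct) auto

lemma nth_run: "k < length vs \<Longrightarrow> run g vs p ! k = vs ! k"
  by (induction g vs p rule: run.induct) (auto simp: nth_append)

lemma run_append: "run g vs (p @ q) = run g (run g vs p) q"
  by (induction g vs p rule: run.induct) auto

lemma legal_operand_mono: "legal_operand s r \<Longrightarrow> s \<le> t \<Longrightarrow> legal_operand t r"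
  by (induction r) auto

lemma operand_value_run:
  "legal_operand (length vs) r \<Longrightarrow> operand_value g (run g vs p) r = operand_value g vs r"
  by (induction r) (auto simp: nth_run)

lemma legal_computation_append:
  "legal_computation s (p @ q) \<longleftrightarrow> legal_computation s p \<and> legal_computation (s + length p) q"
  by (induction s p rule: legal_computation.induct) auto

text \<open>Known quantities are replaced by operands rather than renumbered, since the result of an
  earlier computation may itself be a constant, an entry or a negation that is stored
  nowhere.\<close>

fun subst_operand :: "(nat \<Rightarrow> 'm operand) \<Rightarrow> 'm operand \<Rightarrow> 'm operand" where
  "subst_operand \<sigma> (Const c) = Const c"
| "subst_operand \<sigma> (Entry l) = Entry l"
| "subst_operand \<sigma> (Available k) = \<sigma> k"
| "subst_operand \<sigma> (Neg a) = Neg (subst_operand \<sigma> a)"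

definition subst_computation :: "(nat \<Rightarrow> 'm operand) \<Rightarrow> 'm computation \<Rightarrow> 'm computation" where
  "subst_computation \<sigma> =
     map (\<lambda>(a, b, c). (subst_operand \<sigma> a, subst_operand \<sigma> b, subst_operand \<sigma> c))"

lemma subst_computation_simps [simp]:
  "subst_computation \<sigma> [] = []"
  "subst_computation \<sigma> ((a, b, c) # p) =
     (subst_operand \<sigma> a, subst_operand \<sigma> b, subst_operand \<sigma> c) # subst_computation \<sigma> p"
  "length (subst_computation \<sigma> p) = length p"
  by (auto simp: subst_computation_def)

lemma legal_subst_operand:
  assumes "legal_operand s a" "\<And>k. k < s \<Longrightarrow> legal_operand t (\<sigma> k)"
  shows "legal_operand t (subst_operand \<sigma> a)"
  using assms(1) by (induction a) (auto simp: assms(2))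

lemma operand_value_subst:
  assumes "legal_operand (length vs) a" "\<And>k. k < length vs \<Longrightarrow> operand_value g ws (\<sigma> k) = vs ! k"
  shows "operand_value g ws (subst_operand \<sigma> a) = operand_value g vs a"
  using assms(1) by (induction a) (auto simp: assms(2))

text \<open>
  Relocates a program with \<open>n\<close> inputs: its inputs become the operands \<open>r\<close>, and its own results are
  stored from place \<open>B\<close> onwards.
\<close>

definition relocate :: "nat \<Rightarrow> nat \<Rightarrow> (nat \<Rightarrow> 'm operand) \<Rightarrow> nat \<Rightarrow> 'm operand" where
  "relocate n B r k = (if k < n then r k else Available (B + (k - n)))"

lemma legal_relocate:
  assumes "\<And>k. k < n \<Longrightarrow> legal_operand B (r k)" "k < n + j"
  shows "legal_operand (B + j) (relocate n B r k)"
  using assms(2) legal_operand_mono[OF assms(1), of k "B + j"] by (auto simp: relocate_def)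

text \<open>\<open>j\<close> counts the program's own results stored so far; it is there for the
  induction, which raises it by one at each step. A whole program is the case
  \<open>j = 0\<close>.\<close>

lemma legal_computation_relocate:
  assumes r: "\<And>k. k < n \<Longrightarrow> legal_operand B (r k)"
  shows "legal_computation (n + j) p \<Longrightarrow>
    legal_computation (B + j) (subst_computation (relocate n B r) p)"
proof (induction p arbitrary: j)
  case (Cons x p)
  obtain a b c where x: "x = (a, b, c)" by (cases x)
  show ?case
    using Cons.prems Cons.IH[of "Suc j"] unfolding x
    by (auto intro!: legal_subst_operand[where s = "n + j"] legal_relocate r)
qed simp

text \<open>A simulation: \<open>vs\<close> and \<open>ws\<close> grow in lockstep, and the length
  equation, kept free of subtraction, says that the next result of both runs is matched by
  \<open>relocate\<close>.\<close>

lemma operand_value_run_relocate: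
  assumes r: "\<And>k. k < n \<Longrightarrow> legal_operand B (r k)"
    and "n \<le> length vs" "length ws + n = B + length vs"
    and "\<And>k. k < length vs \<Longrightarrow> operand_value g ws (relocate n B r k) = vs ! k"
    and "legal_computation (length vs) p"
    and "legal_operand (length vs + length p) a"
  shows "operand_value g (run g ws (subst_computation (relocate n B r) p))
           (subst_operand (relocate n B r) a) = operand_value g (run g vs p) a"
  using assms(2-)
proof (induction p arbitrary: vs ws)
  case Nil
  then show ?case by (simp add: operand_value_subst)
next
  case (Cons x p)
  obtain a' b c where x: "x = (a', b, c)" by (cases x)
  let ?\<sigma> = "relocate n B r"
  let ?v = "operand_value g vs a' + operand_value g vs b * operand_value g vs c"
  have legal: "legal_operand (length vs) a'" "legal_operand (length vs) b"
    "legal_operand (length vs) c" "legal_computation (Suc (length vs)) p"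
    using Cons.prems(4) by (auto simp: x)
  have step: "operand_value g ws (subst_operand ?\<sigma> d) = operand_value g vs d"
    if "legal_operand (length vs) d" for d
    using that Cons.prems(3) by (rule operand_value_subst)
  have "operand_value g (ws @ [?v]) (?\<sigma> k) = (vs @ [?v]) ! k" if "k < length (vs @ [?v])" for k
  proof (cases "k < length vs")
    case True
    have ws: "length ws = B + (length vs - n)"
      using Cons.prems(1,2) by simp
    have "legal_operand (length ws) (?\<sigma> k)"
      unfolding ws using r by (rule legal_relocate) (use True Cons.prems(1) in simp_all)
    then have "operand_value g (ws @ [?v]) (?\<sigma> k) = operand_value g ws (?\<sigma> k)"
      \<comment> \<open>The dummy step computes \<open>?v + 0 * 0\<close>, so running it merely
        appends \<open>?v\<close>.\<close>
      using operand_value_run[of ws "?\<sigma> k" g "[(Const ?v, Const 0, Const 0)]"] by simp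
    with True Cons.prems(3) show ?thesis by (simp add: nth_append)
  next
    case False
    with that have "k = length vs" by simp
    moreover from this have "?\<sigma> k = Available (length ws)"
      using Cons.prems(1,2) by (simp add: relocate_def)
    ultimately show ?thesis by simp
  qed
  then show ?case
    using Cons.IH[of "vs @ [?v]" "ws @ [?v]"] Cons.prems(1,2,5) legal by (simp add: x step)
qed

lemma computable_within_mono:
  "computable_within Z F k \<Longrightarrow> F' \<subseteq> F \<Longrightarrow> k \<le> k' \<Longrightarrow> computable_within Z F' k'"
  unfolding computable_within_def by (meson order_trans subsetD)

text \<open>The second program runs after the first, reading its inputs from the operands that hold
  the first one's results. Those operands keep their values because a run only appends.\<close>

lemma computable_within_compose:
  assumes "computable_within Z F k" "set Z' \<subseteq> F" "computable_within Z' F' k'"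
  shows "computable_within Z (F \<union> F') (k + k')"
proof -
  obtain p R where p: "legal_computation (length Z) p" "real (length p) \<le> k"
    and R: "\<And>y. y \<in> F \<Longrightarrow> legal_operand (length Z + length p) (R y)"
      "\<And>y g. y \<in> F \<Longrightarrow> operand_value g (run g (map (\<lambda>z. z \<bullet> g) Z) p) (R y) = y \<bullet> g"
    using assms(1) unfolding computable_within_def by metis
  obtain q Q where q: "legal_computation (length Z') q" "real (length q) \<le> k'"
    and Q: "\<And>y. y \<in> F' \<Longrightarrow> legal_operand (length Z' + length q) (Q y)"
      "\<And>y g. y \<in> F' \<Longrightarrow> operand_value g (run g (map (\<lambda>z. z \<bullet> g) Z') q) (Q y) = y \<bullet> g"
    using assms(3) unfolding computable_within_def by metis
  \<comment> \<open>The first free place once \<open>p\<close> has run.\<close>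
  define B where "B = length Z + length p"
  define \<sigma> where "\<sigma> = relocate (length Z') B (\<lambda>i. R (Z' ! i))"
  define q' where "q' = subst_computation \<sigma> q"
  have in_F: "Z' ! i \<in> F" if "i < length Z'" for i
    using assms(2) that by auto
  have legal: "legal_operand B (R (Z' ! i))" if "i < length Z'" for i
    using R(1) in_F[OF that] by (simp add: B_def)
  show ?thesis
    unfolding computable_within_def
  proof (intro exI[of _ "p @ q'"] conjI ballI)
    show "legal_computation (length Z) (p @ q')"
      using p(1) q(1) legal_computation_relocate[OF legal, where j = 0 and p = q]
      by (simp add: legal_computation_append q'_def \<sigma>_def flip: B_def)
    show "real (length (p @ q')) \<le> k + k'"
      using p(2) q(2) by (simp add: q'_def)
  next
    fix y assume "y \<in> F \<union> F'"
    then consider "y \<in> F" | "y \<in> F'" by blast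
    then show "\<exists>r. legal_operand (length Z + length (p @ q')) r \<and>
      (\<forall>g. operand_value g (run g (map (\<lambda>z. z \<bullet> g) Z) (p @ q')) r = y \<bullet> g)"
    proof cases
      case 1
      then show ?thesis
        using R[OF 1] by (intro exI[of _ "R y"])
          (auto simp: run_append operand_value_run intro: legal_operand_mono)
    next
      case 2
      have "legal_operand (B + length q) (subst_operand \<sigma> (Q y))"
        unfolding \<sigma>_def by (rule legal_subst_operand[OF Q(1)[OF 2]] legal_relocate legal)+
      moreover have "operand_value g (run g (run g (map (\<lambda>z. z \<bullet> g) Z) p) q')
          (subst_operand \<sigma> (Q y)) = y \<bullet> g" for g
        unfolding q'_def \<sigma>_def
        by (subst operand_value_run_relocate[where vs = "map (\<lambda>z. z \<bullet> g) Z'"])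
          (auto simp: legal Q[OF 2] q(1) R(2) in_F relocate_def simp flip: B_def)
      ultimately show ?thesis
        by (intro exI[of _ "subst_operand \<sigma> (Q y)"]) (auto simp: run_append B_def q'_def add_ac)
    qed
  qed
qed

section \<open>Direct computation of an inner product\<close>

lemma computable_within_axis: "computable_within [x] {x + axis l c} 1"
  unfolding computable_within_def
  by (rule exI[of _ "[(Available 0, Const c, Entry l)]"])
    (auto intro!: exI[of _ "Available 1"] simp: inner_add_left inner_axis')

text \<open>The nonzero coordinates are added one at a time, one multiply-add pair each, starting
  from the free constant 0.\<close>

lemma computable_within_direct:
  fixes y :: "real^'m"
  shows "computable_within Z {y} (real (card {l. y $ l \<noteq> 0}))"
proof -
  have "computable_within Z {\<Sum>l\<in>A. axis l (y $ l)} (real (card A))" if "finite A" for A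
    using that
  proof induction
    case empty
    show ?case
      unfolding computable_within_def by (auto intro!: exI[of _ "[]"] exI[of _ "Const 0"])
  next
    case (insert l A)
    show ?case
      \<comment> \<open>Composition also keeps the previous partial sum among the results;
        monotonicity discards it.\<close>
      by (rule computable_within_mono[OF computable_within_compose
            [OF insert.IH _ computable_within_axis[of _ l "y $ l"]]])
        (use insert in \<open>auto simp: add_ac\<close>)
  qed
  moreover have "(\<Sum>l | y $ l \<noteq> 0. axis l (y $ l)) = y"
    by (auto simp: vec_eq_iff axis_def if_distrib sum.delta cong: if_cong)
  ultimately show ?thesis
    by (metis finite)
qed

section \<open>Computing along a connected graph\<close>

text \<open>The definition speaks only of bounds below the dimension. Otherwise direct computation
  is cheap enough, as a vector has at most \<open>CARD('m)\<close> nonzero entries.\<close>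

lemma complexity_reducing_computable:
  fixes Y :: "nat \<Rightarrow> real^'m"
  assumes "complexity_reducing n Y \<rho>" "i \<in> {1..n}" "j \<in> {1..n}"
  shows "computable_within [Y j] {Y i} (\<rho> i j)"
proof (cases "\<rho> i j < real CARD('m)")
  case True
  with assms show ?thesis unfolding complexity_reducing_def by blast
next
  case False
  have "real (card {l. Y i $ l \<noteq> 0}) \<le> real CARD('m)"
    by (simp add: card_mono)
  with False show ?thesis
    by (intro computable_within_mono[OF computable_within_direct]) auto
qed

text \<open>A path from \<open>c\<close> to a vertex outside \<open>S\<close> must leave
  \<open>S\<close> along some edge, so a proper subset containing \<open>c\<close> can always be
  enlarged by the end of such an edge.\<close>

lemma connected_graph_induct [consumes 3, case_names root edge]:
  assumes "connected_graph V T" "finite V" "c \<in> V"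
    and root: "P {c}"
    and edge: "\<And>S u v. S \<subseteq> V \<Longrightarrow> u \<in> S \<Longrightarrow> v \<in> V - S \<Longrightarrow> {u, v} \<in> T \<Longrightarrow> P S \<Longrightarrow> P (insert v S)"
    and T: "T \<subseteq> Pow V"
  shows "P V"
proof -
  have "\<exists>S. S \<subseteq> V \<and> c \<in> S \<and> card S = Suc k \<and> P S" if "k < card V" for k
    using that
  proof (induction k)
    case 0
    show ?case using assms(3) root by (intro exI[of _ "{c}"]) auto
  next
    case (Suc k)
    then obtain S where S: "S \<subseteq> V" "c \<in> S" "card S = Suc k" "P S" by auto
    then obtain w where w: "w \<in> V" "w \<notin> S"
      using Suc.prems by (metis less_irrefl subsetI subset_antisym)
    have "(c, w) \<in> {(a, b). {a, b} \<in> T}\<^sup>*"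
      using assms(1,3) w(1) by (simp add: connected_graph_def)
    \<comment> \<open>Induction along the path: either it has stayed in \<open>S\<close> so far, or
      it has already crossed the boundary.\<close>
    then have "w \<notin> S \<longrightarrow> (\<exists>u v. u \<in> S \<and> v \<notin> S \<and> {u, v} \<in> T)"
      by induction (use S(2) in auto)
    with w(2) obtain u v where uv: "u \<in> S" "v \<notin> S" "{u, v} \<in> T" by blast
    then have "v \<in> V" using T by auto
    then show ?case
      using S uv edge[of S u v] finite_subset[OF S(1) assms(2)]
      by (intro exI[of _ "insert v S"]) auto
  qed
  from this[of "card V - 1"] obtain S where "S \<subseteq> V" "card S = card V" "P S"
    using assms(2,3) card_gt_0_iff[of V] by auto
  then show ?thesis
    using card_subset_eq[OF assms(2)] by metis
qed

theorem theorem3p4: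
  fixes n :: nat and Y :: "nat \<Rightarrow> real^'m" and \<rho> :: "nat \<Rightarrow> nat \<Rightarrow> real"
    and T :: "nat set set"
  assumes "n \<ge> 1"
    and "complexity_reducing n Y \<rho>"
    and "minimum_spanning_tree {1..n} (complete_edges {1..n}) (edge_weight \<rho>) T"
  shows "computable_within [] (Y ` {1..n})
           (real (Min ((\<lambda>i. card {l. Y i $ l \<noteq> 0}) ` {1..n})) + sum (edge_weight \<rho>) T)"
proof -
  let ?V = "{1..n}" and ?w = "edge_weight \<rho>"
  define m where "m = Min ((\<lambda>i. card {l. Y i $ l \<noteq> 0}) ` ?V)"
  have T: "T \<subseteq> complete_edges ?V" "connected_graph ?V T"
    using assms(3) by (auto simp: minimum_spanning_tree_def spanning_tree_def)
  have T_Pow: "T \<subseteq> Pow ?V"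
    using T(1) by (auto simp: complete_edges_def)
  then have "finite T"
    by (rule finite_subset) simp
  \<comment> \<open>The arguments are swapped because \<open>v\<close> will be the new member,
    computed from \<open>u\<close> at cost \<open>\<rho> v u\<close>.\<close>
  have weight: "?w {u, v} = \<rho> v u" if "u \<in> ?V" "v \<in> ?V" for u v
  proof -
    have "\<rho> u v = \<rho> v u"
      using assms(2) that unfolding complexity_reducing_def by blast
    with edge_weight_eq[of \<rho> u v] show ?thesis by simp
  qed
  have nonneg: "0 \<le> ?w e" if e: "e \<in> T" for e
  proof -
    obtain u v where uv: "e = {u, v}" "u \<in> ?V" "v \<in> ?V"
      using T(1) e unfolding complete_edges_def by blast
    then have "0 \<le> \<rho> v u"
      using assms(2) unfolding complexity_reducing_def by blast
    with uv weight show ?thesis by simp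
  qed
  have "m \<in> (\<lambda>i. card {l. Y i $ l \<noteq> 0}) ` ?V"
    unfolding m_def using assms(1) by (intro Min_in) auto
  then obtain c where c: "c \<in> ?V" "m = card {l. Y c $ l \<noteq> 0}"
    by auto
  \<comment> \<open>The sum over \<open>T\<close> is written with the vertex set visible, so that
    the induction can replace \<open>?V\<close> by \<open>S\<close> in both places.\<close>
  have "computable_within [] (Y ` ?V) (real m + sum ?w {e \<in> T. e \<subseteq> ?V})"
    using T(2) finite_atLeastAtMost c(1)
  proof (induction rule: connected_graph_induct)
    case root
    have "0 \<le> sum ?w {e \<in> T. e \<subseteq> {c}}"
      by (intro sum_nonneg nonneg) simp
    then show ?case
      by (intro computable_within_mono[OF computable_within_direct[of _ "Y c"]]) (auto simp: c(2))
  next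
    case (edge S u v)
    have uv: "u \<in> ?V" "v \<in> ?V"
      using edge by auto
    have "sum ?w {e \<in> T. e \<subseteq> S} + \<rho> v u = sum ?w (insert {u, v} {e \<in> T. e \<subseteq> S})"
      using \<open>finite T\<close> edge(3) by (simp add: weight[OF uv])
    \<comment> \<open>Any further edges from \<open>v\<close> into \<open>S\<close> would only
      increase the right-hand side, by \<open>nonneg\<close>.\<close>
    also have "\<dots> \<le> sum ?w {e \<in> T. e \<subseteq> insert v S}"
      using \<open>finite T\<close> edge(2,4) nonneg by (intro sum_mono2) auto
    finally have "sum ?w {e \<in> T. e \<subseteq> S} + \<rho> v u \<le> sum ?w {e \<in> T. e \<subseteq> insert v S}" .
    \<comment> \<open>The second computation has the single input \<open>Y u\<close>, already among
      the results for \<open>S\<close>.\<close>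
    moreover have "computable_within [] (Y ` S \<union> {Y v}) (real m + sum ?w {e \<in> T. e \<subseteq> S} + \<rho> v u)"
      by (rule computable_within_compose[OF edge(5) _
            complexity_reducing_computable[OF assms(2) uv(2,1)]]) (use edge(2) in simp)
    ultimately show ?case
      by (elim computable_within_mono) auto
  qed (use T_Pow in auto)
  moreover have "{e \<in> T. e \<subseteq> ?V} = T"
    using T_Pow by auto
  ultimately show ?thesis
    by (simp add: m_def)
qed

end
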